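(* Let $n,d\ge 1$ and let $F\colon\mathbb{R}^d\to\mathbb{R}\cup\{+\infty\}$ have a minimizer $x_\star\in\operatorname{argmin}_{x\in\mathbb{R}^d}F(x)$ with finite optimal value $F(x_\star)$. Let $\phi\colon\mathbb{R}^d\to\mathbb{R}^d$ be a map and, for each integer $k\ge 0$, let $A_k\in\mathbb{R}^{n\times n}$, $B_k\in\mathbb{R}^{n\times d}$, $C_k,E_k\in\mathbb{R}^{d\times n}$. Let the sequences $\xi_k\in\mathbb{R}^n$, $u_k,y_k,x_k\in\mathbb{R}^d$ ($k\ge 0$) satisfy $$\xi_{k+1}=A_k\xi_k+B_ku_k,\quad y_k=C_k\xi_k,\quad u_k=\phi(y_k),\quad x_k=E_k\xi_k .$$ Assume: 1. There are $\xi_\star\in\mathbb{R}^n$ and $u_\star,y_\star\in\mathbb{R}^d$ such that, for all $k$, $\xi_\star=A_k\xi_\star+B_ku_\star$, $y_\star=C_k\xi_\star$, $u_\star=\phi(y_\star)$, $x_\star=E_k\xi_\star=y_\star$. 2. There are symmetric matrices $M_k^1,M_k^2,M_k^3\in\mathbb{R}^{(n+d)\times(n+d)}$, with each $M_k^3$ either zero or indefinite, such that, with $e_k=[(\xi_k-\xi_\star)^\top\ (u_k-u_\star)^\top]^\top\in\mathbb{R}^{n+d}$, for all $k$ $$F(x_{k+1})-F(x_k)\le e_k^\top M_k^1e_k,\qquad F(x_{k+1})-F(x_\star)\le e_k^\top M_k^2e_k,\qquad 0\le e_k^\top M_k^3e_k .$$ 3. There are a nonnegative nondecreasing real sequence $\{a_k\}$,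 a sequence of nonnegative reals $\{\sigma_k\}$, and a sequence of symmetric positive semidefinite matrices $P_k\in\mathbb{R}^{n\times n}$ such that for all $k$ $$M_k^0+a_kM_k^1+(a_{k+1}-a_k)M_k^2+\sigma_kM_k^3\preceq 0,\qquad M_k^0=\begin{bmatrix}A_k^\top P_{k+1}A_k-P_k & A_k^\top P_{k+1}B_k\\ B_k^\top P_{k+1}A_k & B_k^\top P_{k+1}B_k\end{bmatrix}.$$ Then, for all $k$ with $a_k>0$, $$F(x_k)-F(x_\star)\le\frac{a_0\,(F(x_0)-F(x_\star))+(\xi_0-\xi_\star)^\top P_0(\xi_0-\xi_\star)}{a_k}.$$
   Context: A symmetric matrix is indefinite if it is neither positive semidefinite nor negative semidefinite. $M\preceq 0$ means that the symmetric matrix $M$ is negative semidefinite. Inequalities involving values of $F$ are read in the extended reals: $F(x_{k+1})-F(x_k)\le c$ means $F(x_{k+1})\le F(x_k)+c$, and $0\cdot(+\infty)=0$. *)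

theory Defs
  imports "HOL-Analysis.Analysis"
begin

definition symmetric_matrix :: "real^'m^'m \<Rightarrow> bool" where
  "symmetric_matrix M \<longleftrightarrow> transpose M = M"

definition quad_form :: "real^'m^'m \<Rightarrow> real^'m \<Rightarrow> real" where
  "quad_form M v = v \<bullet> (M *v v)"

definition pos_semidef :: "real^'m^'m \<Rightarrow> bool" where
  "pos_semidef M \<longleftrightarrow> symmetric_matrix M \<and> (\<forall>v. 0 \<le> quad_form M v)"

definition neg_semidef :: "real^'m^'m \<Rightarrow> bool" where
  "neg_semidef M \<longleftrightarrow> symmetric_matrix M \<and> (\<forall>v. quad_form M v \<le> 0)"

definition indefinite :: "real^'m^'m \<Rightarrow> bool" where
  "indefinite M \<longleftrightarrow> symmetric_matrix M \<and> \<not> pos_semidef M \<and> \<not> neg_semidef M"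

text \<open>Vectors of dimension \<open>n + d\<close> and block matrices are indexed by the disjoint sum of the
  index types of the blocks.\<close>

definition stack_vec :: "real^'n \<Rightarrow> real^'d \<Rightarrow> real^('n + 'd)" where
  "stack_vec v w = (\<chi> i. case i of Inl p \<Rightarrow> v $ p | Inr q \<Rightarrow> w $ q)"

text \<open>\<open>block_matrix P Q R S\<close> has first block row \<open>P, Q\<close> and second block row \<open>R, S\<close>.\<close>

definition block_matrix ::
  "real^'n^'m \<Rightarrow> real^'d^'m \<Rightarrow> real^'n^'q \<Rightarrow> real^'d^'q \<Rightarrow> real^('n + 'd)^('m + 'q)" where
  "block_matrix P Q R S = (\<chi> i j.
     case i of
       Inl r \<Rightarrow> (case j of Inl c \<Rightarrow> P $ r $ c | Inr c \<Rightarrow> Q $ r $ c)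
     | Inr r \<Rightarrow> (case j of Inl c \<Rightarrow> R $ r $ c | Inr c \<Rightarrow> S $ r $ c))"

text \<open>The matrix \<open>M\<^sub>k\<^sup>0\<close>; the last two arguments are \<open>P\<^sub>k\<close> and \<open>P\<^sub>k\<^sub>+\<^sub>1\<close>.\<close>

definition lyapunov_matrix ::
  "real^'n^'n \<Rightarrow> real^'d^'n \<Rightarrow> real^'n^'n \<Rightarrow> real^'n^'n \<Rightarrow> real^('n + 'd)^('n + 'd)" where
  "lyapunov_matrix A B P P' = block_matrix
     (transpose A ** P' ** A - P) (transpose A ** P' ** B)
     (transpose B ** P' ** A)     (transpose B ** P' ** B)"

end

theory Submission
  imports Defs
begin

text \<open>The Lyapunov function
  \<open>V\<^sub>k = a\<^sub>k (F(x\<^sub>k) - F(x\<^sub>\<star>)) + (\<xi>\<^sub>k - \<xi>\<^sub>\<star>)\<^sup>T P\<^sub>k (\<xi>\<^sub>k - \<xi>\<^sub>\<star>)\<close> is nonincreasing: evaluating the matrix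
  inequality at \<open>e\<^sub>k\<close> turns its first term into the increment of the quadratic part, while the terms
  with \<open>M\<^sub>k\<^sup>1\<close> and \<open>M\<^sub>k\<^sup>2\<close>, weighted by \<open>a\<^sub>k\<close> and \<open>a\<^sub>k\<^sub>+\<^sub>1 - a\<^sub>k\<close>, dominate the increment of the
  function-value part, and the term with \<open>M\<^sub>k\<^sup>3\<close> is nonnegative. The second bound makes \<open>F(x\<^sub>k)\<close>
  finite for \<open>k \<ge> 1\<close>; an infinite \<open>F(x\<^sub>0)\<close> makes the claim trivial unless \<open>a\<^sub>0 = 0\<close>, and then
  \<open>F(x\<^sub>0)\<close> enters nowhere.\<close>

lemma sum_UNIV_Plus:
  fixes f :: "'a::finite + 'b::finite \<Rightarrow> 'c::comm_monoid_add"
  shows "sum f UNIV = (\<Sum>i\<in>UNIV. f (Inl i)) + (\<Sum>j\<in>UNIV. f (Inr j))"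
  by (simp add: UNIV_Plus_UNIV[symmetric] sum.Plus del: UNIV_Plus_UNIV)

lemma inner_stack_vec: "stack_vec v w \<bullet> stack_vec v' w' = v \<bullet> v' + w \<bullet> w'"
  by (simp add: inner_vec_def sum_UNIV_Plus stack_vec_def)

lemma block_matrix_mult_stack_vec:
  "block_matrix P Q R S *v stack_vec v w = stack_vec (P *v v + Q *v w) (R *v v + S *v w)"
  by (simp add: vec_eq_iff matrix_vector_mult_def sum_UNIV_Plus stack_vec_def block_matrix_def
      split: sum.split)

text \<open>The adjoint law is phrased with \<open>v*\<close> because simp rewrites
  \<open>transpose A *v w\<close> to \<open>w v* A\<close>.\<close>

lemma inner_vector_matrix_mult: "v \<bullet> (w v* A) = (A *v v) \<bullet> w"
  for A :: "real^'n^'m"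
  by (metis dot_lmul_matrix inner_commute)

lemma quad_form_add: "quad_form (M + N) v = quad_form M v + quad_form N v"
  by (simp add: quad_form_def matrix_vector_mult_add_rdistrib inner_add_right)

lemma quad_form_scaleR: "quad_form (c *\<^sub>R M) v = c * quad_form M v"
  by (simp add: quad_form_def scaleR_matrix_vector_assoc[symmetric])

text \<open>Moving the transposed factors across the inner product gathers the four blocks into one
  form at \<open>A *v v + B *v w\<close>.\<close>

lemma quad_form_lyapunov_matrix:
  "quad_form (lyapunov_matrix A B P P') (stack_vec v w) =
    quad_form P' (A *v v + B *v w) - quad_form P v"
  by (simp add: quad_form_def lyapunov_matrix_def block_matrix_mult_stack_vec inner_stack_vec
      matrix_vector_mult_diff_rdistrib matrix_vector_mul_assoc[symmetric] inner_vector_matrix_mult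
      matrix_vector_right_distrib inner_add_left inner_add_right inner_diff_right)

theorem theorem3p1:
  fixes F :: "real^'d \<Rightarrow> ereal"
    and \<phi> :: "real^'d \<Rightarrow> real^'d"
    and A :: "nat \<Rightarrow> real^'n^'n" and B :: "nat \<Rightarrow> real^'d^'n"
    and C E :: "nat \<Rightarrow> real^'n^'d"
    and \<xi> :: "nat \<Rightarrow> real^'n" and u y x :: "nat \<Rightarrow> real^'d"
    and \<xi>\<^sub>s :: "real^'n" and u\<^sub>s y\<^sub>s x\<^sub>s :: "real^'d"
    and M1 M2 M3 :: "nat \<Rightarrow> real^('n + 'd)^('n + 'd)"
    and e :: "nat \<Rightarrow> real^('n + 'd)"
    and a \<sigma> :: "nat \<Rightarrow> real"
    and P :: "nat \<Rightarrow> real^'n^'n"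
  assumes F_proper: "\<And>z. F z \<noteq> -\<infinity>"
    and minimizer: "is_arg_min F (\<lambda>z. z \<in> UNIV) x\<^sub>s"
    and finite_opt: "F x\<^sub>s \<noteq> \<infinity>"
    and dyn_\<xi>: "\<And>k. \<xi> (Suc k) = A k *v \<xi> k + B k *v u k"
    and dyn_y: "\<And>k. y k = C k *v \<xi> k"
    and dyn_u: "\<And>k. u k = \<phi> (y k)"
    and dyn_x: "\<And>k. x k = E k *v \<xi> k"
    and fix_\<xi>: "\<And>k. \<xi>\<^sub>s = A k *v \<xi>\<^sub>s + B k *v u\<^sub>s"
    and fix_y: "\<And>k. y\<^sub>s = C k *v \<xi>\<^sub>s"
    and fix_u: "u\<^sub>s = \<phi> y\<^sub>s"
    and fix_x: "\<And>k. x\<^sub>s = E k *v \<xi>\<^sub>s"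
    and fix_xy: "x\<^sub>s = y\<^sub>s"
    and sym_M1: "\<And>k. symmetric_matrix (M1 k)"
    and sym_M2: "\<And>k. symmetric_matrix (M2 k)"
    and sym_M3: "\<And>k. symmetric_matrix (M3 k)"
    and M3_zero_or_indef: "\<And>k. M3 k = 0 \<or> indefinite (M3 k)"
    and e_def: "\<And>k. e k = stack_vec (\<xi> k - \<xi>\<^sub>s) (u k - u\<^sub>s)"
    and bound1: "\<And>k. F (x (Suc k)) \<le> F (x k) + ereal (quad_form (M1 k) (e k))"
    and bound2: "\<And>k. F (x (Suc k)) - F x\<^sub>s \<le> ereal (quad_form (M2 k) (e k))"
    and bound3: "\<And>k. 0 \<le> quad_form (M3 k) (e k)"
    and a_nonneg: "\<And>k. 0 \<le> a k"
    and a_mono: "incseq a"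
    and \<sigma>_nonneg: "\<And>k. 0 \<le> \<sigma> k"
    and P_psd: "\<And>k. pos_semidef (P k)"
    and lmi: "\<And>k. neg_semidef
      (lyapunov_matrix (A k) (B k) (P k) (P (Suc k))
        + a k *\<^sub>R M1 k + (a (Suc k) - a k) *\<^sub>R M2 k + \<sigma> k *\<^sub>R M3 k)"
  shows "\<forall>k. a k > 0 \<longrightarrow>
    F (x k) - F x\<^sub>s \<le>
      (ereal (a 0) * (F (x 0) - F x\<^sub>s) + ereal (quad_form (P 0) (\<xi> 0 - \<xi>\<^sub>s))) / ereal (a k)"
proof (intro allI impI)
  \<comment> \<open>An infinite gap becomes 0 here; this can happen only for
    \<open>k = 0\<close>.\<close>
  define f where "f k = real_of_ereal (F (x k) - F x\<^sub>s)" for k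
  define q where "q k = quad_form (P k) (\<xi> k - \<xi>\<^sub>s)" for k
  obtain s where s: "F x\<^sub>s = ereal s"
    using F_proper finite_opt by (cases "F x\<^sub>s") auto
  have f_eq: "F (x k) - F x\<^sub>s = ereal (f k)" if "F (x k) \<noteq> \<infinity>" for k
    using that F_proper[of "x k"] by (cases "F (x k)") (auto simp: f_def s)
  have fin: "F (x (Suc k)) \<noteq> \<infinity>" for k
    using bound2[of k] by (auto simp: s)
  have q_step: "q (Suc k) - q k + a k * quad_form (M1 k) (e k)
      + (a (Suc k) - a k) * quad_form (M2 k) (e k) \<le> 0" for k
  proof -
    have "\<xi> (Suc k) - \<xi>\<^sub>s = A k *v (\<xi> k - \<xi>\<^sub>s) + B k *v (u k - u\<^sub>s)"
      \<comment> \<open>Subtracting the fixed-point equation from the dynamics.\<close>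
      by (subst fix_\<xi>[of k]) (simp add: dyn_\<xi> matrix_vector_mult_diff_distrib)
    then have "q (Suc k) - q k = quad_form (lyapunov_matrix (A k) (B k) (P k) (P (Suc k))) (e k)"
      by (simp add: q_def e_def quad_form_lyapunov_matrix)
    moreover have "0 \<le> \<sigma> k * quad_form (M3 k) (e k)"
      using \<sigma>_nonneg bound3 by simp
    moreover have "quad_form (lyapunov_matrix (A k) (B k) (P k) (P (Suc k))
        + a k *\<^sub>R M1 k + (a (Suc k) - a k) *\<^sub>R M2 k + \<sigma> k *\<^sub>R M3 k) (e k) \<le> 0"
      using lmi unfolding neg_semidef_def by blast
    ultimately show ?thesis
      by (simp add: quad_form_add quad_form_scaleR)
  qed
  fix k assume ak: "a k > 0"
  show "F (x k) - F x\<^sub>s \<le>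
      (ereal (a 0) * (F (x 0) - F x\<^sub>s) + ereal (quad_form (P 0) (\<xi> 0 - \<xi>\<^sub>s))) / ereal (a k)"
  proof (cases "F (x 0) = \<infinity> \<and> a 0 > 0")
    case True
    with ak show ?thesis by (simp add: s)
  next
    case False
    then have a0: "a 0 = 0" if "F (x 0) = \<infinity>"
      using that a_nonneg[of 0] by auto
    \<comment> \<open>The weight \<open>a j\<close> is kept: if \<open>F (x 0)\<close> is infinite,
      \<open>f 0\<close> is a default value and \<open>a 0 = 0\<close> saves the case
      \<open>j = 0\<close>.\<close>
    have f_step: "a j * f (Suc j) \<le> a j * (f j + quad_form (M1 j) (e j))" for j
    proof (cases "F (x j) = \<infinity>")
      case True
      then have "j = 0" using fin by (cases j) auto
      with True a0 show ?thesis by simp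
    next
      case False
      with bound1[of j] F_proper[of "x j"] F_proper[of "x (Suc j)"] fin[of j]
      have "f (Suc j) \<le> f j + quad_form (M1 j) (e j)"
        by (cases "F (x j)"; cases "F (x (Suc j))") (auto simp: f_def s)
      then show ?thesis using a_nonneg by (rule mult_left_mono)
    qed
    have V_step: "a (Suc j) * f (Suc j) + q (Suc j) \<le> a j * f j + q j" for j
    proof -
      have "f (Suc j) \<le> quad_form (M2 j) (e j)"
        using bound2[of j] by (simp add: f_eq[OF fin])
      \<comment> \<open>Of \<open>a (Suc j) * f (Suc j)\<close>, this bounds the share with weight
        \<open>a (Suc j) - a j\<close>; \<open>f_step\<close> bounds the rest.\<close>
      then have "(a (Suc j) - a j) * f (Suc j) \<le> (a (Suc j) - a j) * quad_form (M2 j) (e j)"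
        using incseq_SucD[OF a_mono, of j] by (intro mult_left_mono) auto
      with f_step[of j] q_step[of j] show ?thesis
        by (simp add: algebra_simps)
    qed
    have "a k * f k + q k \<le> a 0 * f 0 + q 0"
      by (induction k) (use V_step order_trans in \<open>blast+\<close>)
    moreover have "0 \<le> q k"
      using P_psd by (simp add: q_def pos_semidef_def)
    ultimately have "f k \<le> (a 0 * f 0 + q 0) / a k"
      using ak by (simp add: field_simps)
    \<comment> \<open>For \<open>k = 0\<close>, the assumption \<open>a k > 0\<close> excludes an
      infinite \<open>F (x 0)\<close> through \<open>a0\<close>.\<close>
    moreover have "F (x k) - F x\<^sub>s = ereal (f k)"
      using f_eq fin a0 ak by (cases k) auto
    \<comment> \<open>If \<open>F (x 0)\<close> is infinite, both sides are 0, as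
      \<open>0 * \<infinity> = 0\<close> in \<open>ereal\<close>.\<close>
    moreover have "ereal (a 0) * (F (x 0) - F x\<^sub>s) = ereal (a 0 * f 0)"
      using f_eq[of 0] a0 by (cases "F (x 0) = \<infinity>") (auto simp flip: zero_ereal_def)
    ultimately show ?thesis
      using ak by (simp add: q_def)
  qed
qed

end
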